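(* Let $Q$ be a finite quiver with vertices $1,\dots,n$ and no oriented cycles, and let $\mathcal{A}(Q)$ be the (coefficient-free) cluster algebra with initial seed $(\underline{x},Q)$. Then a seed of $\mathcal{A}(Q)$ is determined by its cluster: if $(\underline{u},\Gamma)$ and $(\underline{u}',\Gamma')$ are seeds of $\mathcal{A}(Q)$ whose clusters coincide as sets, say $u'_j=u_{\sigma(j)}$ for a permutation $\sigma$, then $\Gamma'$ is obtained from $\Gamma$ by relabelling vertices via $\sigma$ (i.e. the number of arrows $j\to l$ in $\Gamma'$ equals the number of arrows $\sigma(j)\to\sigma(l)$ in $\Gamma$).
   Context: Cluster algebra: a seed is a pair $(\underline{u},\Gamma)$ with $\underline{u}=(u_1,\dots,u_n)$ elements of $\mathbb{Q}(x_1,\dots,x_n)$ and $\Gamma$ a quiver on vertices $1,\dots,n$ without loops or 2-cycles, vertex $j$ attached to $u_j$. Mutation $\mu_i$ replaces $\Gamma$ by the quiver obtained by adding an arrow $j\to l$ for each path $j\to i\to l$, reversing arrows at $i$ and removing a maximal set of 2-cycles, and replaces $u_i$ by $u_i^{\ast}=(\prod_{j\to i}u_j+\prod_{i\to l}u_l)/u_i$ (products over arrows of $\Gamma$ with multiplicity). Seeds of $\mathcal{A}(Q)$ are those reachable from the initial seed $(\underline{x},Q)$, $\underline{x}=\{x_1,\dots,x_n\}$, by finite sequences of mutations; the cluster of a seed is the set $\{u_1,\dots,u_n\}$. *)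

theory Defs
  imports Complex_Main "HOL-Library.Poly_Mapping" "HOL-Computational_Algebra.Fraction_Field"
begin

text \<open>Multivariate polynomials over Q in the variables x_0, x_1, ... (only x_1..x_n are used),
  and their fraction field, the field of rational functions Q(x_1,...,x_n,...).\<close>

type_synonym mpoly = "(nat \<Rightarrow>\<^sub>0 nat) \<Rightarrow>\<^sub>0 rat"
type_synonym ratfun = "mpoly fract"

definition var :: "nat \<Rightarrow> ratfun" where
  "var i = Fract (Poly_Mapping.single (Poly_Mapping.single i 1) 1) 1"

text \<open>A quiver on vertices 1..n is given by its arrow multiplicities:
  Q j l = number of arrows j \<rightarrow> l. Arrows only between vertices in {1..n}.\<close>

type_synonym quiver = "nat \<Rightarrow> nat \<Rightarrow> nat"

definition is_quiver :: "nat \<Rightarrow> quiver \<Rightarrow> bool" where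
  "is_quiver n Q \<longleftrightarrow> (\<forall>j l. Q j l > 0 \<longrightarrow> j \<in> {1..n} \<and> l \<in> {1..n})
     \<and> (\<forall>j. Q j j = 0) \<and> (\<forall>j l. Q j l = 0 \<or> Q l j = 0)"

definition no_oriented_cycles :: "quiver \<Rightarrow> bool" where
  "no_oriented_cycles Q \<longleftrightarrow> acyclic {(j, l). Q j l > 0}"

text \<open>Quiver mutation at i: add an arrow j\<rightarrow>l for each path j\<rightarrow>i\<rightarrow>l, reverse arrows at i,
  remove a maximal set of 2-cycles.\<close>

definition mutate_quiver :: "nat \<Rightarrow> quiver \<Rightarrow> quiver" where
  "mutate_quiver i Q = (\<lambda>j l.
     if j = i \<or> l = i then Q l j
     else (Q j l + Q j i * Q i l) - (Q l j + Q l i * Q i j))"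

definition mutate_cluster :: "nat \<Rightarrow> nat \<Rightarrow> quiver \<Rightarrow> (nat \<Rightarrow> ratfun) \<Rightarrow> (nat \<Rightarrow> ratfun)" where
  "mutate_cluster n i Q u = u(i :=
     ((\<Prod>j\<in>{1..n}. u j ^ Q j i) + (\<Prod>l\<in>{1..n}. u l ^ Q i l)) / u i)"

definition mutate_seed :: "nat \<Rightarrow> nat \<Rightarrow> (nat \<Rightarrow> ratfun) \<times> quiver \<Rightarrow> (nat \<Rightarrow> ratfun) \<times> quiver" where
  "mutate_seed n i s = (mutate_cluster n i (snd s) (fst s), mutate_quiver i (snd s))"

inductive is_seed :: "nat \<Rightarrow> quiver \<Rightarrow> (nat \<Rightarrow> ratfun) \<times> quiver \<Rightarrow> bool"
  for n :: nat and Q :: quiver where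
  initial: "is_seed n Q (var, Q)"
| mutate: "is_seed n Q s \<Longrightarrow> i \<in> {1..n} \<Longrightarrow> is_seed n Q (mutate_seed n i s)"

end

theory Submission
  imports Defs
begin

text \<open>
  The signed adjacency matrix \<open>b\<close> of the quiver of a seed \<open>u\<close> gives the 2-form
  \<open>\<Sum> b i j dlog u\<^sub>i \<and> dlog u\<^sub>j\<close>, which does not change under mutation. The forms
  \<open>dlog u\<^sub>i\<close> stay linearly independent, so the coefficients of this fixed 2-form with respect to
  the cluster determine \<open>b\<close>, and \<open>b\<close> determines the quiver since there are no 2-cycles.
  It is enough to look at the point \<open>(1, \<dots>, 1)\<close>, where all cluster variables are positive:
  there \<open>dlog u\<^sub>i\<close> is the functional sending a tangent vector \<open>v\<close> to the logarithmic
  derivative of \<open>u\<^sub>i\<close> in direction \<open>v\<close>.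
\<close>

section \<open>Value and directional derivative of a polynomial at the all-ones point\<close>

text \<open>The linear extension of \<open>f\<close> from basis elements to finitely supported
  combinations. It serves both for polynomials, as combinations of monomials, and for exponent
  vectors, as combinations of variable indices.\<close>

definition coeff_sum :: "('a \<Rightarrow> 'b) \<Rightarrow> ('a \<Rightarrow>\<^sub>0 'b) \<Rightarrow> 'b::semiring_0" where
  "coeff_sum f p = (\<Sum>m\<in>Poly_Mapping.keys p. Poly_Mapping.lookup p m * f m)"

lemma coeff_sum_add: "coeff_sum f (p + q) = coeff_sum f p + coeff_sum f q"
  unfolding coeff_sum_def
  by (rule setsum_keys_plus_distrib) (auto simp: distrib_right)

lemma coeff_sum_0 [simp]: "coeff_sum f 0 = 0"
  by (simp add: coeff_sum_def)

lemma coeff_sum_single [simp]: "coeff_sum f (Poly_Mapping.single m c) = c * f m"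
  by (simp add: coeff_sum_def)

lemma poly_mapping_induct_add [case_names zero single_add]:
  assumes "P 0"
    and "\<And>m c p. P p \<Longrightarrow> P (Poly_Mapping.single m c + p)"
  shows "P (p :: 'a \<Rightarrow>\<^sub>0 'b::monoid_add)"
proof (induction p rule: update_induct)
  case const
  show ?case by fact
next
  case (update p m c)
  have "Poly_Mapping.update m c p = Poly_Mapping.single m c + p"
    using update.hyps
    by (intro poly_mapping_eqI) (auto simp: lookup_update lookup_add lookup_single in_keys_iff)
  then show ?case using assms(2) update.IH by simp
qed

definition at_ones :: "mpoly \<Rightarrow> rat" where
  "at_ones = coeff_sum (\<lambda>_. 1)"

text \<open>The inner \<open>coeff_sum\<close> pairs the exponents of a monomial with
  \<open>v\<close>. This is the derivative of the monomial along \<open>v\<close>, because every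
  monomial has value 1 at the all-ones point.\<close>

definition deriv_at_ones :: "(nat \<Rightarrow> rat) \<Rightarrow> mpoly \<Rightarrow> rat" where
  "deriv_at_ones v = coeff_sum (coeff_sum v \<circ> Poly_Mapping.map of_nat)"

lemma coeff_sum_map_of_nat_add:
  "coeff_sum v (Poly_Mapping.map of_nat (m + m')) =
   coeff_sum v (Poly_Mapping.map of_nat m) +
   coeff_sum (v :: 'a \<Rightarrow> 'b::semiring_1) (Poly_Mapping.map of_nat m')"
proof -
  have "Poly_Mapping.map of_nat (m + m') =
      Poly_Mapping.map of_nat m + (Poly_Mapping.map of_nat m' :: 'a \<Rightarrow>\<^sub>0 'b)"
    by (intro poly_mapping_eqI) (simp add: lookup_add Poly_Mapping.map.rep_eq when_def)
  then show ?thesis by (simp add: coeff_sum_add)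
qed

lemma at_ones_add: "at_ones (p + q) = at_ones p + at_ones q"
  by (simp add: at_ones_def coeff_sum_add)

lemma deriv_at_ones_add:
  "deriv_at_ones v (p + q) = deriv_at_ones v p + deriv_at_ones v q"
  by (simp add: deriv_at_ones_def coeff_sum_add)

lemma at_ones_0 [simp]: "at_ones 0 = 0"
  by (simp add: at_ones_def)

lemma deriv_at_ones_0 [simp]: "deriv_at_ones v 0 = 0"
  by (simp add: deriv_at_ones_def)

lemma at_ones_single [simp]: "at_ones (Poly_Mapping.single m c) = c"
  by (simp add: at_ones_def)

lemma deriv_at_ones_single:
  "deriv_at_ones v (Poly_Mapping.single m c) = c * coeff_sum v (Poly_Mapping.map of_nat m)"
  by (simp add: deriv_at_ones_def)

lemma at_ones_1 [simp]: "at_ones 1 = 1"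
  by (simp flip: single_one)

lemma deriv_at_ones_1 [simp]: "deriv_at_ones v 1 = 0"
proof -
  have "Poly_Mapping.map of_nat 0 = (0 :: nat \<Rightarrow>\<^sub>0 rat)"
    by (intro poly_mapping_eqI) (simp add: Poly_Mapping.map.rep_eq)
  then show ?thesis by (simp add: deriv_at_ones_single flip: single_one)
qed

lemma deriv_at_ones_variable:
  "deriv_at_ones v (Poly_Mapping.single (Poly_Mapping.single i 1) 1) = v i"
proof -
  have "Poly_Mapping.map of_nat (Poly_Mapping.single i 1) = Poly_Mapping.single i (1::rat)"
    by (intro poly_mapping_eqI) (simp add: Poly_Mapping.map.rep_eq lookup_single when_def)
  then show ?thesis by (simp add: deriv_at_ones_single)
qed

lemma at_ones_mult: "at_ones (p * q) = at_ones p * at_ones q"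
proof (induction p rule: poly_mapping_induct_add)
  case (single_add m c p)
  have "at_ones (Poly_Mapping.single m c * q) = c * at_ones q"
    by (induction q rule: poly_mapping_induct_add)
       (simp_all add: distrib_left at_ones_add mult_single)
  then show ?case using single_add by (simp add: distrib_right at_ones_add)
qed simp

text \<open>Both sides are bilinear in \<open>p\<close> and \<open>q\<close>, so nested inductions
  reduce the Leibniz rule to two monomials, where it is additivity of exponents.\<close>

lemma deriv_at_ones_mult:
  "deriv_at_ones v (p * q) = deriv_at_ones v p * at_ones q + at_ones p * deriv_at_ones v q"
proof (induction p rule: poly_mapping_induct_add)
  case (single_add m c p)
  have "deriv_at_ones v (Poly_Mapping.single m c * q) =
      deriv_at_ones v (Poly_Mapping.single m c) * at_ones q + c * deriv_at_ones v q"
    by (induction q rule: poly_mapping_induct_add)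
       (simp_all add: deriv_at_ones_add at_ones_add mult_single deriv_at_ones_single
          coeff_sum_map_of_nat_add algebra_simps)
  then show ?case
    using single_add by (simp add: deriv_at_ones_add at_ones_add algebra_simps)
qed simp

section \<open>Logarithmic derivatives of rational functions\<close>

text \<open>Asking for positive rather than nonzero values gives a class closed under sums as well
  as products and quotients, so the binomial of an exchange relation cannot vanish at the
  point.\<close>

definition positive_fract :: "mpoly \<Rightarrow> mpoly \<Rightarrow> ratfun \<Rightarrow> bool" where
  "positive_fract p q r \<longleftrightarrow> at_ones p > 0 \<and> at_ones q > 0 \<and> r = Fract p q"

definition positive :: "ratfun \<Rightarrow> bool" where
  "positive r \<longleftrightarrow> (\<exists>p q. positive_fract p q r)"

definition val :: "ratfun \<Rightarrow> rat" where
  "val r = (THE a. \<exists>p q. positive_fract p q r \<and> a = at_ones p / at_ones q)"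

definition log_deriv :: "(nat \<Rightarrow> rat) \<Rightarrow> ratfun \<Rightarrow> rat" where
  "log_deriv v r = (THE d. \<exists>p q. positive_fract p q r \<and>
     d = deriv_at_ones v p / at_ones p - deriv_at_ones v q / at_ones q)"

lemma positive_fract_cross:
  assumes "positive_fract p q r" "positive_fract p' q' r"
  shows "p * q' = p' * q"
proof -
  have "q \<noteq> 0" "q' \<noteq> 0" using assms by (auto simp: positive_fract_def)
  then show ?thesis using assms by (auto simp: positive_fract_def eq_fract)
qed

lemma val_eq:
  assumes "positive_fract p q r"
  shows "val r = at_ones p / at_ones q"
  unfolding val_def
proof (rule the_equality)
  fix a assume "\<exists>p q. positive_fract p q r \<and> a = at_ones p / at_ones q"
  then obtain p' q' where *: "positive_fract p' q' r" "a = at_ones p' / at_ones q'" by blast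
  have "at_ones p * at_ones q' = at_ones p' * at_ones q"
    using positive_fract_cross[OF assms *(1)] by (metis at_ones_mult)
  then show "a = at_ones p / at_ones q"
    using assms *(1) unfolding *(2) by (simp add: positive_fract_def frac_eq_eq)
qed (use assms in blast)

text \<open>Two representatives satisfy \<open>p * q' = p' * q\<close>. Logarithmic derivatives turn
  these products into sums, and rearranging gives independence of the representative.\<close>

lemma log_deriv_eq:
  assumes "positive_fract p q r"
  shows "log_deriv v r = deriv_at_ones v p / at_ones p - deriv_at_ones v q / at_ones q"
  unfolding log_deriv_def
proof (rule the_equality)
  fix d assume "\<exists>p q. positive_fract p q r \<and>
      d = deriv_at_ones v p / at_ones p - deriv_at_ones v q / at_ones q"
  then obtain p' q' where *: "positive_fract p' q' r"
      "d = deriv_at_ones v p' / at_ones p' - deriv_at_ones v q' / at_ones q'" by blast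
  have nz: "at_ones p \<noteq> 0" "at_ones q \<noteq> 0" "at_ones p' \<noteq> 0" "at_ones q' \<noteq> 0"
    using assms * by (auto simp: positive_fract_def)
  have log: "deriv_at_ones v (f * g) / at_ones (f * g) =
      deriv_at_ones v f / at_ones f + deriv_at_ones v g / at_ones g"
    if "at_ones f \<noteq> 0" "at_ones g \<noteq> 0" for f g
    using that by (simp add: deriv_at_ones_mult at_ones_mult field_simps)
  have "deriv_at_ones v p / at_ones p + deriv_at_ones v q' / at_ones q' =
      deriv_at_ones v p' / at_ones p' + deriv_at_ones v q / at_ones q"
    using positive_fract_cross[OF assms *(1)] log[of p q'] log[of p' q] nz by simp
  then show "d = deriv_at_ones v p / at_ones p - deriv_at_ones v q / at_ones q"
    using * by (simp add: algebra_simps)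
qed (use assms in blast)

lemma positiveE:
  assumes "positive r"
  obtains p q where "positive_fract p q r"
  using assms by (auto simp: positive_def)

lemma positive_imp_val_pos: "positive r \<Longrightarrow> val r > 0"
  by (auto simp: positive_def val_eq) (simp add: positive_fract_def)

section \<open>Closure of positivity and the rules of logarithmic differentiation\<close>

lemma positive_fract_mult:
  "positive_fract p q r \<Longrightarrow> positive_fract p' q' r' \<Longrightarrow>
   positive_fract (p * p') (q * q') (r * r')"
  by (auto simp: positive_fract_def at_ones_mult)

lemma positive_fract_divide:
  "positive_fract p q r \<Longrightarrow> positive_fract p' q' r' \<Longrightarrow>
   positive_fract (p * q') (q * p') (r / r')"
  by (auto simp: positive_fract_def at_ones_mult)

lemma positive_fract_add:
  assumes "positive_fract p q r" "positive_fract p' q' r'"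
  shows "positive_fract (p * q' + p' * q) (q * q') (r + r')"
proof -
  have "q \<noteq> 0" "q' \<noteq> 0" using assms by (auto simp: positive_fract_def)
  then show ?thesis using assms
    by (auto simp: positive_fract_def at_ones_mult at_ones_add intro!: add_pos_pos)
qed

lemma positive_mult: "positive r \<Longrightarrow> positive s \<Longrightarrow> positive (r * s)"
  unfolding positive_def by (blast intro: positive_fract_mult)

lemma positive_divide: "positive r \<Longrightarrow> positive s \<Longrightarrow> positive (r / s)"
  unfolding positive_def by (blast intro: positive_fract_divide)

lemma positive_add: "positive r \<Longrightarrow> positive s \<Longrightarrow> positive (r + s)"
  unfolding positive_def by (blast intro: positive_fract_add)

lemma log_deriv_mult:
  assumes "positive r" "positive s"
  shows "log_deriv v (r * s) = log_deriv v r + log_deriv v s"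
proof -
  obtain p q p' q' where pq: "positive_fract p q r" "positive_fract p' q' s"
    using assms by (meson positiveE)
  show ?thesis
    using pq
    by (simp add: log_deriv_eq[OF pq(1)] log_deriv_eq[OF pq(2)]
        log_deriv_eq[OF positive_fract_mult[OF pq]])
       (simp add: positive_fract_def deriv_at_ones_mult at_ones_mult field_simps)
qed

lemma log_deriv_divide:
  assumes "positive r" "positive s"
  shows "log_deriv v (r / s) = log_deriv v r - log_deriv v s"
proof -
  obtain p q p' q' where pq: "positive_fract p q r" "positive_fract p' q' s"
    using assms by (meson positiveE)
  show ?thesis
    using pq
    by (simp add: log_deriv_eq[OF pq(1)] log_deriv_eq[OF pq(2)]
        log_deriv_eq[OF positive_fract_divide[OF pq]])
       (simp add: positive_fract_def deriv_at_ones_mult at_ones_mult field_simps)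
qed

text \<open>By d(r + s) = r dlog r + s dlog s, the result is an average weighted by the values of
  the summands. This is the origin of the weight in a mutation.\<close>

lemma log_deriv_add:
  assumes "positive r" "positive s"
  shows "log_deriv v (r + s) =
    (val r * log_deriv v r + val s * log_deriv v s) / (val r + val s)"
proof -
  obtain p q p' q' where pq: "positive_fract p q r" "positive_fract p' q' s"
    using assms by (meson positiveE)
  define a b a' b' where ab: "a = at_ones p" "b = at_ones q" "a' = at_ones p'" "b' = at_ones q'"
  have "a > 0" "b > 0" "a' > 0" "b' > 0" using pq by (auto simp: ab positive_fract_def)
  then have "a * b' + a' * b > 0" by (simp add: add_pos_pos)
  define da db da' db' where d: "da = deriv_at_ones v p" "db = deriv_at_ones v q"
    "da' = deriv_at_ones v p'" "db' = deriv_at_ones v q'"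
  have nz: "a \<noteq> 0" "b \<noteq> 0" "a' \<noteq> 0" "b' \<noteq> 0" "a * b' + a' * b \<noteq> 0"
    using \<open>a > 0\<close> \<open>b > 0\<close> \<open>a' > 0\<close> \<open>b' > 0\<close> \<open>a * b' + a' * b > 0\<close> by auto
  have vs: "a / b + a' / b' = (a * b' + a' * b) / (b * b')"
    using nz by (simp add: field_simps)
  \<comment> \<open>The quotient \<open>(p * q' + p' * q) / (q * q')\<close> differentiated
    logarithmically, against the weighted average, with all values and derivatives abstracted to
    atoms.\<close>
  have "(da * b' + a * db' + (da' * b + a' * db)) / (a * b' + a' * b)
      - (db * b' + b * db') / (b * b') =
      (a / b * (da / a - db / b) + a' / b' * (da' / a' - db' / b')) / (a / b + a' / b')"
    unfolding vs using nz by (simp add: divide_simps) (simp add: algebra_simps)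
  then show ?thesis
    by (simp add: log_deriv_eq[OF pq(1)] log_deriv_eq[OF pq(2)] val_eq[OF pq(1)] val_eq[OF pq(2)]
        log_deriv_eq[OF positive_fract_add[OF pq]] deriv_at_ones_mult deriv_at_ones_add
        at_ones_mult at_ones_add flip: ab d)
qed

lemma positive_fract_1: "positive_fract 1 1 1"
  by (simp add: positive_fract_def One_fract_def)

lemma positive_1: "positive 1"
  using positive_fract_1 by (auto simp: positive_def)

lemma log_deriv_1: "log_deriv v 1 = 0"
  by (simp add: log_deriv_eq[OF positive_fract_1])

lemma positive_power_log_deriv:
  assumes "positive r"
  shows "positive (r ^ k) \<and> log_deriv v (r ^ k) = of_nat k * log_deriv v r"
  by (induction k)
     (simp_all add: positive_1 log_deriv_1 positive_mult log_deriv_mult assms algebra_simps)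

lemma positive_prod_power_log_deriv:
  assumes "\<And>i. i \<in> I \<Longrightarrow> positive (u i)"
  shows "positive (\<Prod>i\<in>I. u i ^ k i) \<and>
    log_deriv v (\<Prod>i\<in>I. u i ^ k i) = (\<Sum>i\<in>I. of_nat (k i) * log_deriv v (u i))"
  using assms
  by (induction I rule: infinite_finite_induct)
     (simp_all add: positive_1 log_deriv_1 positive_mult log_deriv_mult positive_power_log_deriv)

lemma positive_fract_var:
  "positive_fract (Poly_Mapping.single (Poly_Mapping.single i 1) 1) 1 (var i)"
  by (simp add: positive_fract_def var_def)

lemma positive_var: "positive (var i)"
  using positive_fract_var by (auto simp: positive_def)

lemma log_deriv_var: "log_deriv v (var i) = v i"
  using log_deriv_eq[OF positive_fract_var, of v i] deriv_at_ones_variable[of v i] by simp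

section \<open>Mutation invariance of the 2-form\<close>

definition signed_arrows :: "quiver \<Rightarrow> nat \<Rightarrow> nat \<Rightarrow> rat" where
  "signed_arrows Q i j = of_nat (Q i j) - of_nat (Q j i)"

text \<open>By skew-symmetry of \<open>signed_arrows\<close>, this is the sum over i < j of b i j
  dlog u_i \<and> dlog u_j, evaluated at two tangent vectors on which the dlog u_i take the values
  \<open>x i\<close> and \<open>y i\<close>.\<close>

definition quiver_form :: "nat \<Rightarrow> quiver \<Rightarrow> (nat \<Rightarrow> rat) \<Rightarrow> (nat \<Rightarrow> rat) \<Rightarrow> rat" where
  "quiver_form n Q x y = (\<Sum>i\<in>{1..n}. \<Sum>j\<in>{1..n}. signed_arrows Q i j * x i * y j)"

text \<open>The exchange relation in logarithmic coordinates. In use, \<open>a\<close> is the share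
  of the incoming monomial in the sum of the two monomials at the all-ones point.\<close>

definition weighted_mutation :: "nat \<Rightarrow> rat \<Rightarrow> nat \<Rightarrow> quiver \<Rightarrow> (nat \<Rightarrow> rat) \<Rightarrow> nat \<Rightarrow> rat" where
  "weighted_mutation n a k Q x = x(k := - x k
     + a * (\<Sum>j\<in>{1..n}. of_nat (Q j k) * x j)
     + (1 - a) * (\<Sum>j\<in>{1..n}. of_nat (Q k j) * x j))"

lemma is_quiver_mutate:
  assumes "is_quiver n Q" "k \<in> {1..n}"
  shows "is_quiver n (mutate_quiver k Q)"
proof -
  have 1: "Q j l = 0" if "j \<notin> {1..n} \<or> l \<notin> {1..n}" for j l
    using assms(1) that unfolding is_quiver_def by (metis gr0I)
  have 2: "Q j j = 0" for j
    using assms(1) by (auto simp: is_quiver_def)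
  have 3: "Q j l = 0 \<or> Q l j = 0" for j l
    using assms(1) by (auto simp: is_quiver_def)
  have "mutate_quiver k Q j l = 0" if "j \<notin> {1..n} \<or> l \<notin> {1..n}" for j l
    using 1 that by (auto simp: mutate_quiver_def)
  moreover have "mutate_quiver k Q j j = 0" for j
    using 2 by (auto simp: mutate_quiver_def)
  moreover have "mutate_quiver k Q j l = 0 \<or> mutate_quiver k Q l j = 0" for j l
    using 3 by (auto simp: mutate_quiver_def)
  ultimately show ?thesis unfolding is_quiver_def by (metis gr_implies_not0)
qed

text \<open>Truncated subtraction in the two opposite directions cancels the 2-cycles, and the
  difference of the two truncated values is the plain difference. Signed counts thus follow matrix
  mutation.\<close>

lemma signed_arrows_mutate:
  "signed_arrows (mutate_quiver k Q) i j =
    (if i = k \<or> j = k then - signed_arrows Q i j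
     else signed_arrows Q i j + of_nat (Q i k) * of_nat (Q k j) - of_nat (Q j k) * of_nat (Q k i))"
proof -
  have "(of_nat (a - b) :: rat) - of_nat (b - a) = of_nat a - of_nat b" for a b
    by (cases a b rule: le_cases) (simp_all add: of_nat_diff)
  from this[of "Q i j + Q i k * Q k j" "Q j i + Q j k * Q k i"]
  show ?thesis by (simp add: signed_arrows_def mutate_quiver_def)
qed

lemma sum_sum_remove:
  fixes f :: "'a \<Rightarrow> 'a \<Rightarrow> 'b::ab_group_add"
  assumes "finite I" "k \<in> I"
  shows "(\<Sum>i\<in>I. \<Sum>j\<in>I. f i j) =
    (\<Sum>i\<in>I-{k}. \<Sum>j\<in>I-{k}. f i j) + (\<Sum>i\<in>I-{k}. f i k) + (\<Sum>j\<in>I-{k}. f k j) + f k k"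
  using assms by (simp add: sum.remove[of I k] sum.distrib algebra_simps)

lemma quiver_form_split:
  assumes "k \<in> {1..n}" "Q k k = 0"
  defines "J \<equiv> {1..n} - {k}"
  shows "quiver_form n Q x y = (\<Sum>i\<in>J. \<Sum>j\<in>J. signed_arrows Q i j * x i * y j)
    + (\<Sum>i\<in>J. signed_arrows Q i k * x i) * y k + x k * (\<Sum>j\<in>J. signed_arrows Q k j * y j)"
  unfolding quiver_form_def J_def
  using assms(1,2)
  by (subst sum_sum_remove[of _ k])
     (simp_all add: signed_arrows_def sum_distrib_left sum_distrib_right mult_ac)

text \<open>
  For \<open>P = \<Sum>j. Q j k * x j\<close>, \<open>M = \<Sum>j. Q k j * x j\<close> and likewise \<open>P'\<close>, \<open>M'\<close> for \<open>y\<close>, the new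
  arrows contribute \<open>P * M' - M * P'\<close>, which is cancelled by the change of the \<open>k\<close>-th coordinates,
  whatever the weight \<open>a\<close> is.
\<close>

lemma quiver_form_mutate:
  assumes "is_quiver n Q" "k \<in> {1..n}"
  shows "quiver_form n (mutate_quiver k Q) (weighted_mutation n a k Q x) (weighted_mutation n a k Q y)
    = quiver_form n Q x y"
proof -
  define J where "J = {1..n} - {k}"
  define P M where "P = (\<lambda>x. \<Sum>j\<in>J. of_nat (Q j k) * x j :: rat)"
    and "M = (\<lambda>x. \<Sum>j\<in>J. of_nat (Q k j) * x j :: rat)"
  have Qkk: "Q k k = 0" and Q'kk: "mutate_quiver k Q k k = 0"
    using assms(1) by (auto simp: is_quiver_def mutate_quiver_def)
  have full: "(\<Sum>j\<in>{1..n}. of_nat (Q j k) * x j) = P x"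
    "(\<Sum>j\<in>{1..n}. of_nat (Q k j) * x j) = M x" for x :: "nat \<Rightarrow> rat"
    unfolding P_def M_def J_def using assms(2) Qkk by (simp_all add: sum.remove[of _ k])
  let ?w = "weighted_mutation n a k Q"
  have wk: "?w x k = - x k + a * P x + (1 - a) * M x" for x
    unfolding weighted_mutation_def full by simp
  have wJ: "?w x j = x j" if "j \<in> J" for x j
    using that by (simp add: weighted_mutation_def J_def)
  have col: "(\<Sum>i\<in>J. signed_arrows Q i k * x i) = P x - M x"
    and row: "(\<Sum>i\<in>J. signed_arrows Q k i * x i) = M x - P x" for x
    by (simp_all add: P_def M_def signed_arrows_def left_diff_distrib sum_subtractf)
  \<comment> \<open>Arrows at \<open>k\<close> are reversed while the coordinates in
    \<open>J\<close> stay fixed, so row and column sums just change sign.\<close>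
  have col': "(\<Sum>i\<in>J. signed_arrows (mutate_quiver k Q) i k * ?w x i) = M x - P x"
    and row': "(\<Sum>i\<in>J. signed_arrows (mutate_quiver k Q) k i * ?w x i) = P x - M x" for x
    using col[of x] row[of x] by (simp_all add: signed_arrows_mutate wJ sum_negf)
  have "(\<Sum>i\<in>J. \<Sum>j\<in>J. signed_arrows (mutate_quiver k Q) i j * ?w x i * ?w y j) =
      (\<Sum>i\<in>J. \<Sum>j\<in>J. signed_arrows Q i j * x i * y j
         + (of_nat (Q i k) * x i) * (of_nat (Q k j) * y j)
         - (of_nat (Q k i) * x i) * (of_nat (Q j k) * y j))"
    by (intro sum.cong refl)
       (simp add: wJ signed_arrows_mutate, simp add: J_def algebra_simps)
  also have "\<dots> = (\<Sum>i\<in>J. \<Sum>j\<in>J. signed_arrows Q i j * x i * y j) + P x * M y - M x * P y"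
    by (simp add: sum.distrib sum_subtractf P_def M_def sum_product)
  \<comment> \<open>The weight enters the \<open>k\<close>-th coordinates only as
    \<open>a * (P - M)\<close>; its row and column contributions are opposite multiples of
    \<open>(P x - M x) * (P y - M y)\<close>.\<close>
  finally show ?thesis
    unfolding quiver_form_split[of k n "mutate_quiver k Q", OF assms(2) Q'kk, folded J_def]
      quiver_form_split[of k n Q, OF assms(2) Qkk, folded J_def] col row col' row'
    by (simp add: wk algebra_simps)
qed

section \<open>Seeds\<close>

text \<open>The weight is obtained before \<open>v\<close> is chosen: it depends only on the values
  of the two monomials. Both arguments of the form therefore transform with the same
  \<open>a\<close>.\<close>

lemma mutate_cluster_log_deriv:
  assumes "k \<in> {1..n}" and pos: "\<And>i. i \<in> {1..n} \<Longrightarrow> positive (u i)"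
  obtains a where
    "\<And>v. (\<lambda>i. log_deriv v (mutate_cluster n k Q u i)) =
      weighted_mutation n a k Q (\<lambda>i. log_deriv v (u i))"
proof -
  let ?P = "\<Prod>j\<in>{1..n}. u j ^ Q j k" and ?M = "\<Prod>l\<in>{1..n}. u l ^ Q k l"
  have P: "positive ?P"
    and LP: "\<And>v. log_deriv v ?P = (\<Sum>j\<in>{1..n}. of_nat (Q j k) * log_deriv v (u j))"
    using positive_prod_power_log_deriv[of "{1..n}" u "\<lambda>j. Q j k"] pos by auto
  have M: "positive ?M"
    and LM: "\<And>v. log_deriv v ?M = (\<Sum>j\<in>{1..n}. of_nat (Q k j) * log_deriv v (u j))"
    using positive_prod_power_log_deriv[of "{1..n}" u "\<lambda>j. Q k j"] pos by auto
  define a where "a = val ?P / (val ?P + val ?M)"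
  have "val ?P > 0" "val ?M > 0" using P M by (auto intro: positive_imp_val_pos)
  then have a: "1 - a = val ?M / (val ?P + val ?M)"
    by (simp add: a_def field_simps)
  have "log_deriv v (?P + ?M) = a * log_deriv v ?P + (1 - a) * log_deriv v ?M" for v
    unfolding a unfolding a_def log_deriv_add[OF P M] by (simp add: add_divide_distrib)
  then have "log_deriv v ((?P + ?M) / u k) =
      a * log_deriv v ?P + (1 - a) * log_deriv v ?M - log_deriv v (u k)" for v
    using log_deriv_divide[OF positive_add[OF P M] pos[OF assms(1)]] by simp
  then have "(\<lambda>i. log_deriv v (mutate_cluster n k Q u i)) =
      weighted_mutation n a k Q (\<lambda>i. log_deriv v (u i))" for v
    by (simp add: fun_eq_iff mutate_cluster_def weighted_mutation_def LP LM del: One_nat_def)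
  then show thesis by (rule that)
qed

text \<open>Without a loop at \<open>k\<close>, the two sums do not see the changed coordinate, so
  the second application undoes the first.\<close>

lemma weighted_mutation_involutive:
  assumes "Q k k = 0" "k \<in> {1..n}"
  shows "weighted_mutation n a k Q (weighted_mutation n a k Q x) = x"
proof -
  let ?w = "weighted_mutation n a k Q"
  have "(\<Sum>j\<in>{1..n}. of_nat (Q j k) * ?w x j) = (\<Sum>j\<in>{1..n}. of_nat (Q j k) * x j)"
    "(\<Sum>j\<in>{1..n}. of_nat (Q k j) * ?w x j) = (\<Sum>j\<in>{1..n}. of_nat (Q k j) * x j)"
    using assms by (auto intro!: sum.cong simp: weighted_mutation_def)
  then show ?thesis by (simp add: weighted_mutation_def fun_eq_iff)
qed

lemma weighted_mutation_cong:
  assumes "\<And>i. i \<in> {1..n} \<Longrightarrow> x i = y i" "i \<in> {1..n}"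
  shows "weighted_mutation n a k Q x i = weighted_mutation n a k Q y i"
  using assms by (auto simp: weighted_mutation_def)

lemma is_quiver_seed: "is_seed n Q s \<Longrightarrow> is_quiver n Q \<Longrightarrow> is_quiver n (snd s)"
  by (induction rule: is_seed.induct) (auto simp: mutate_seed_def is_quiver_mutate)

text \<open>The exchange relation is subtraction-free, so positivity passes from seed to
  seed.\<close>

lemma positive_seed:
  "is_seed n Q s \<Longrightarrow> i \<in> {1..n} \<Longrightarrow> positive (fst s i)"
proof (induction arbitrary: i rule: is_seed.induct)
  case initial
  then show ?case by (simp add: positive_var)
next
  case (mutate s k)
  then show ?case
    using positive_prod_power_log_deriv[of "{1..n}" "fst s"]
    by (auto simp: mutate_seed_def mutate_cluster_def intro!: positive_divide positive_add)
qed

lemma quiver_form_seed: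
  assumes "is_seed n Q s" "is_quiver n Q"
  shows "quiver_form n (snd s) (\<lambda>i. log_deriv v (fst s i)) (\<lambda>i. log_deriv w (fst s i)) =
    quiver_form n Q v w"
  using assms(1)
proof (induction rule: is_seed.induct)
  case initial
  then show ?case by (simp add: log_deriv_var)
next
  case (mutate s k)
  obtain a where "\<And>v. (\<lambda>i. log_deriv v (mutate_cluster n k (snd s) (fst s) i)) =
      weighted_mutation n a k (snd s) (\<lambda>i. log_deriv v (fst s i))"
    using mutate_cluster_log_deriv[of k n "fst s", OF mutate.hyps(2) positive_seed[OF mutate.hyps(1)]]
    by blast
  then show ?case
    using mutate quiver_form_mutate[OF is_quiver_seed[OF mutate.hyps(1) assms(2)] mutate.hyps(2)]
    by (simp add: mutate_seed_def)
qed

text \<open>Linear independence of the forms dlog u_i, in dual form: some tangent vector realises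
  any prescribed values. It survives mutation because the change of coordinates is
  invertible.\<close>

lemma log_deriv_seed_surj:
  assumes "is_seed n Q s" "is_quiver n Q"
  shows "\<exists>v. \<forall>i\<in>{1..n}. log_deriv v (fst s i) = t i"
  using assms(1)
proof (induction arbitrary: t rule: is_seed.induct)
  case initial
  then show ?case by (auto simp: log_deriv_var)
next
  case (mutate s k)
  obtain a where a: "\<And>v. (\<lambda>i. log_deriv v (mutate_cluster n k (snd s) (fst s) i)) =
      weighted_mutation n a k (snd s) (\<lambda>i. log_deriv v (fst s i))"
    using mutate_cluster_log_deriv[of k n "fst s", OF mutate.hyps(2) positive_seed[OF mutate.hyps(1)]]
    by blast
  let ?w = "weighted_mutation n a k (snd s)"
  have loop: "snd s k k = 0"
    using is_quiver_seed[OF mutate.hyps(1) assms(2)] by (auto simp: is_quiver_def)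
  \<comment> \<open>The old cluster is given the mutated target \<open>?w t\<close>, which a second
    mutation turns back into \<open>t\<close>.\<close>
  obtain v where v: "\<forall>i\<in>{1..n}. log_deriv v (fst s i) = ?w t i"
    using mutate.IH by blast
  have "log_deriv v (mutate_cluster n k (snd s) (fst s) i) = t i" if "i \<in> {1..n}" for i
  proof -
    have "log_deriv v (mutate_cluster n k (snd s) (fst s) i) = ?w (\<lambda>i. log_deriv v (fst s i)) i"
      using a[of v] by (rule fun_cong)
    also have "\<dots> = ?w (?w t) i"
      using v that by (intro weighted_mutation_cong) auto
    also have "\<dots> = t i"
      using weighted_mutation_involutive[of "snd s" k n a t] loop mutate.hyps(2) by simp
    finally show ?thesis .
  qed
  then show ?case by (intro exI[of _ v]) (simp add: mutate_seed_def)
qed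

section \<open>Recovering the quiver from the form\<close>

lemma quiver_form_unit:
  assumes "j \<in> {1..n}" "l \<in> {1..n}"
    and "\<And>i. i \<in> {1..n} \<Longrightarrow> x i = of_bool (i = j)"
    and "\<And>i. i \<in> {1..n} \<Longrightarrow> y i = of_bool (i = l)"
  shows "quiver_form n Q x y = signed_arrows Q j l"
proof -
  have "quiver_form n Q x y = (\<Sum>i\<in>{1..n}. \<Sum>m\<in>{1..n}.
      if i = j then (if m = l then signed_arrows Q i m else 0) else 0)"
    unfolding quiver_form_def using assms(3,4) by (intro sum.cong refl) auto
  also have "\<dots> = (\<Sum>i\<in>{1..n}. if i = j then signed_arrows Q i l else 0)"
    using assms(2) by (intro sum.cong refl) auto
  finally show ?thesis using assms(1) by simp
qed

text \<open>Without 2-cycles, the multiplicities in the two directions are the positive and negative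
  parts of the signed count.\<close>

lemma signed_arrows_eq_imp:
  assumes "signed_arrows Q j l = signed_arrows Q' j' l'" "is_quiver n Q" "is_quiver n Q'"
  shows "Q j l = Q' j' l'"
proof -
  have "(of_nat (Q j l + Q' l' j') :: rat) = of_nat (Q' j' l' + Q l j)"
    using assms(1) by (simp add: signed_arrows_def algebra_simps)
  then have "Q j l + Q' l' j' = Q' j' l' + Q l j"
    by (simp only: of_nat_eq_iff)
  moreover have "Q j l = 0 \<or> Q l j = 0" "Q' j' l' = 0 \<or> Q' l' j' = 0"
    using assms(2,3) by (auto simp: is_quiver_def)
  ultimately show ?thesis by auto
qed

theorem theorem4p1:
  fixes n :: nat and Q :: quiver
    and u u' :: "nat \<Rightarrow> ratfun" and \<Gamma> \<Gamma>' :: quiver and \<sigma> :: "nat \<Rightarrow> nat"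
  assumes "is_quiver n Q"
    and "no_oriented_cycles Q"
    and "is_seed n Q (u, \<Gamma>)"
    and "is_seed n Q (u', \<Gamma>')"
    and "bij_betw \<sigma> {1..n} {1..n}"
    and "\<forall>j\<in>{1..n}. u' j = u (\<sigma> j)"
  shows "\<forall>j\<in>{1..n}. \<forall>l\<in>{1..n}. \<Gamma>' j l = \<Gamma> (\<sigma> j) (\<sigma> l)"
proof (intro ballI)
  fix j l assume j: "j \<in> {1..n}" and l: "l \<in> {1..n}"
  have \<sigma>_in: "\<sigma> i \<in> {1..n}" if "i \<in> {1..n}" for i
    using bij_betwE[OF assms(5)] that by blast
  have \<sigma>_eq: "\<sigma> i = \<sigma> i' \<longleftrightarrow> i = i'" if "i \<in> {1..n}" "i' \<in> {1..n}" for i i'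
    using inj_on_eq_iff[OF bij_betw_imp_inj_on[OF assms(5)]] that by blast
  have dual: "\<exists>v. \<forall>i\<in>{1..n}. log_deriv v (u i) = of_bool (i = m)" for m
    using log_deriv_seed_surj[OF assms(3,1)] by simp
  obtain v where v: "\<And>i. i \<in> {1..n} \<Longrightarrow> log_deriv v (u i) = of_bool (i = \<sigma> j)"
    using dual by blast
  obtain w where w: "\<And>i. i \<in> {1..n} \<Longrightarrow> log_deriv w (u i) = of_bool (i = \<sigma> l)"
    using dual by blast
  \<comment> \<open>Since \<open>\<sigma>\<close> is injective, the vectors dual to \<open>u\<close>
    at \<open>\<sigma> j\<close> and \<open>\<sigma> l\<close> are dual to \<open>u'\<close> at
    \<open>j\<close> and \<open>l\<close>.\<close>
  have v': "log_deriv v (u' i) = of_bool (i = j)" if "i \<in> {1..n}" for i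
    using assms(6) v[OF \<sigma>_in[OF that]] \<sigma>_eq[OF that j] that by simp
  have w': "log_deriv w (u' i) = of_bool (i = l)" if "i \<in> {1..n}" for i
    using assms(6) w[OF \<sigma>_in[OF that]] \<sigma>_eq[OF that l] that by simp
  have "signed_arrows \<Gamma>' j l =
      quiver_form n \<Gamma>' (\<lambda>i. log_deriv v (u' i)) (\<lambda>i. log_deriv w (u' i))"
    using quiver_form_unit[OF j l v' w'] by simp
  \<comment> \<open>Both sides equal the form of the initial seed at \<open>v\<close> and
    \<open>w\<close>.\<close>
  also have "\<dots> = quiver_form n \<Gamma> (\<lambda>i. log_deriv v (u i)) (\<lambda>i. log_deriv w (u i))"
    using quiver_form_seed[OF assms(3,1)] quiver_form_seed[OF assms(4,1)] by simp
  also have "\<dots> = signed_arrows \<Gamma> (\<sigma> j) (\<sigma> l)"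
    using quiver_form_unit[OF \<sigma>_in[OF j] \<sigma>_in[OF l] v w] .
  finally show "\<Gamma>' j l = \<Gamma> (\<sigma> j) (\<sigma> l)"
    using is_quiver_seed[OF assms(3,1)] is_quiver_seed[OF assms(4,1)]
    by (auto intro: signed_arrows_eq_imp)
qed

end
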